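(* The strong left overlap division $\mathcal S$ is a Gröbner involutive division: for every field $R$, every admissible monomial ordering $O$ on $R\langle x_1,\dots,x_n\rangle$ and every finite set $G$ of nonzero polynomials that is a Locally Involutive Basis with respect to $\mathcal S$ and $O$, the set $G$ is a (noncommutative) Gröbner Basis, with respect to $O$, of the two-sided ideal it generates.
   Context: Monomials are words in the noncommuting variables $x_1,\dots,x_n$; a monomial ordering (total order on monomials) is admissible if $1<m$ for all $m\neq 1$ and $m_1<m_2$ implies $\ell m_1 r<\ell m_2 r$ for all monomials $\ell,r$. $\mathrm{LM},\mathrm{LC}$ denote leading monomial and coefficient. A weak involutive division (one that is not strong) is called Gröbner if every Locally Involutive Basis with respect to it is a Gröbner Basis. An involutive division is a rule $I$ assigning to every finite set $U$ of monomials and every $u\in U$ a set $\mathcal M^L_I(u,U)\subseteq\{x_1,\dots,x_n\}$ of left multiplicative variables and a set $\mathcal M^R_I(u,U)\subseteq\{x_1,\dots,x_n\}$ of right multiplicative variables. For $u\in U$ and a factorisation $w=v_1uv_2$, $u$ is an involutive divisor of $w$ at this factorisation if (thin divisors) the last letter of $v_1$ (if $v_1\ne1$) is in $\mathcal M^L_I(u,U)$ and the first letter of $v_2$ (if $v_2\neq1$) is in $\mathcal M^R_I(u,U)$. For a finite set $P$ of nonzero polynomials, multiplicative variables of $p\in P$ are those of $\mathrm{LM}(p)$ with respect to $U=\mathrm{LM}(P)$. Involutive reduction of $f$ by $P$: repeatedly take the leading term $c\,w$ of the current polynomial; if some $\mathrm{LM}(p)$, $p\in P$, involutively divides $w$ at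 $w=v_1\mathrm{LM}(p)v_2$, subtract $c\,\mathrm{LC}(p)^{-1}v_1pv_2$; otherwise move $c\,w$ to the remainder. $f$ involutively reduces to zero using $P$ if the final remainder is $0$. $P$ is autoreduced if no $p\in P$ contains a term whose monomial is involutively divisible (multiplicative variables taken over $P$) by $\mathrm{LM}(p')$ for some $p'\in P\setminus\{p\}$. A left (right) prolongation of $p\in P$ is $x_ip$ with $x_i\notin\mathcal M^L_I(\mathrm{LM}(p),\mathrm{LM}(P))$ (resp. $px_i$ with $x_i\notin\mathcal M^R_I(\mathrm{LM}(p),\mathrm{LM}(P))$). An autoreduced $P$ is a Locally Involutive Basis if all left and right prolongations of its elements involutively reduce to zero using $P$. DegRevLex ordering (with $x_1>x_2>\cdots>x_n$): $m_1<m_2$ if $\deg m_1<\deg m_2$, or the degrees are equal and, reading from right to left, at the first position where the words differ the letter of $m_1$ is greater than that of $m_2$. Strong left overlap division $\mathcal S$. Let $U=\{u_1,\dots,u_m\}$ be a finite set of monomials listed so that $u_1>u_2>\cdots>u_m$ in DegRevLex. All variables are left multiplicative for all elements of $U$. Right multiplicative variables: start with all variables right multiplicative. Step 1: (a) whenever $u_j\in U$ occurs as a subword of a different $u_i\in U$ at a position that is not the suffix position, make the letter of $u_i$ immediately to the right of that occurrence right nonmultiplicative for $u_j$; (b) whenever $u_i,u_j\in U$ (possibly equal) and $1\le k<\min(\deg u_i,\deg u_j)$ are such that the prefix of $u_i$ of length $k$ equals the suffix of $u_j$ of length $k$, make the $(k+1)$-st letter of $u_i$ right nonmultiplicative for $u_j$.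 Step 2: for $i=m,m-1,\dots,1$ and, for each $i$, for $j=m,m-1,\dots,1$: if no letter occurring in $u_j$ is currently right nonmultiplicative for $u_i$ (and $\deg u_j\geq 1$), make the first letter of $u_j$ right nonmultiplicative for $u_i$. *)

theory Defs
  imports "HOL.Hull" "HOL-Library.Poly_Mapping" "HOL-Library.Sublist"
begin

section \<open>Words and noncommutative polynomials\<close>

text \<open>Monomials are words in the letters of a type \<open>'x\<close>, multiplied by concatenation.  With this
  monoid structure the convolution product of \<^theory>\<open>HOL-Library.Poly_Mapping\<close> makes
  \<open>'x list \<Rightarrow>\<^sub>0 'k\<close> the free associative algebra over \<open>'k\<close> on the letters \<open>'x\<close>.\<close>

instantiation list :: (type) monoid_add
begin

definition zero_list_def: "0 = []"

definition plus_list_def: "xs + ys = xs @ ys"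

instance
  by standard (simp_all add: zero_list_def plus_list_def)

end

type_synonym 'x word = "'x list"
type_synonym ('x, 'k) ncpoly = "'x word \<Rightarrow>\<^sub>0 'k"

abbreviation nc_term :: "'k::zero \<Rightarrow> 'x word \<Rightarrow> ('x, 'k) ncpoly" where
  "nc_term c w \<equiv> Poly_Mapping.single w c"

abbreviation nc_mono :: "'x word \<Rightarrow> ('x, 'k::zero_neq_one) ncpoly" where
  "nc_mono w \<equiv> nc_term 1 w"

definition two_sided_ideal :: "'a::ring_1 set \<Rightarrow> bool" where
  "two_sided_ideal J \<longleftrightarrow> 0 \<in> J \<and> (\<forall>a\<in>J. \<forall>b\<in>J. a + b \<in> J) \<and>
    (\<forall>a\<in>J. \<forall>r s. r * a * s \<in> J)"

section \<open>Monomial orderings and Groebner bases\<close>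

text \<open>A monomial ordering is given by its strict part.\<close>

definition admissible :: "('x word \<Rightarrow> 'x word \<Rightarrow> bool) \<Rightarrow> bool" where
  "admissible lt \<longleftrightarrow> irreflp lt \<and> transp lt \<and> totalp lt \<and>
    (\<forall>m. m \<noteq> [] \<longrightarrow> lt [] m) \<and>
    (\<forall>m1 m2 l r. lt m1 m2 \<longrightarrow> lt (l @ m1 @ r) (l @ m2 @ r))"

text \<open>Only meaningful for \<open>p \<noteq> 0\<close>.\<close>

definition LM :: "('x word \<Rightarrow> 'x word \<Rightarrow> bool) \<Rightarrow> ('x, 'k::zero) ncpoly \<Rightarrow> 'x word" where
  "LM lt p = (THE m. m \<in> Poly_Mapping.keys p \<and>
    (\<forall>m'\<in>Poly_Mapping.keys p. m' \<noteq> m \<longrightarrow> lt m' m))"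

definition LC :: "('x word \<Rightarrow> 'x word \<Rightarrow> bool) \<Rightarrow> ('x, 'k::zero) ncpoly \<Rightarrow> 'k" where
  "LC lt p = Poly_Mapping.lookup p (LM lt p)"

text \<open>\<^const>\<open>sublist\<close> is the contiguous subword relation, i.e. divisibility of words.\<close>

definition groebner_basis ::
  "('x word \<Rightarrow> 'x word \<Rightarrow> bool) \<Rightarrow> ('x, 'k::field) ncpoly set \<Rightarrow> ('x, 'k) ncpoly set \<Rightarrow> bool" where
  "groebner_basis lt G J \<longleftrightarrow> two_sided_ideal hull G = J \<and>
    (\<forall>f\<in>J. f \<noteq> 0 \<longrightarrow> (\<exists>g\<in>G. g \<noteq> 0 \<and> sublist (LM lt g) (LM lt f)))"

section \<open>Involutive divisions and locally involutive bases\<close>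

text \<open>A division maps \<open>u\<close> and \<open>U\<close> to the pair of the sets of left and right multiplicative variables
  of \<open>u\<close> with respect to \<open>U\<close>; only values at finite \<open>U\<close> and \<open>u \<in> U\<close> matter.\<close>

type_synonym 'x involutive_division = "'x word \<Rightarrow> 'x word set \<Rightarrow> 'x set \<times> 'x set"

text \<open>\<open>u\<close> is an involutive divisor of \<open>v1 @ u @ v2\<close> at this factorisation (thin divisors).\<close>

definition involutive_at ::
  "'x involutive_division \<Rightarrow> 'x word set \<Rightarrow> 'x word \<Rightarrow> 'x word \<Rightarrow> 'x word \<Rightarrow> bool" where
  "involutive_at I U v1 u v2 \<longleftrightarrow>
    (v1 \<noteq> [] \<longrightarrow> last v1 \<in> fst (I u U)) \<and> (v2 \<noteq> [] \<longrightarrow> hd v2 \<in> snd (I u U))"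

definition involutively_divides ::
  "'x involutive_division \<Rightarrow> 'x word set \<Rightarrow> 'x word \<Rightarrow> 'x word \<Rightarrow> bool" where
  "involutively_divides I U u w \<longleftrightarrow> (\<exists>v1 v2. w = v1 @ u @ v2 \<and> involutive_at I U v1 u v2)"

text \<open>States are pairs of the current polynomial and the remainder collected so far.  When several
  divisors or factorisations are available, any of them may be chosen.\<close>

inductive inv_reduction_step ::
  "'x involutive_division \<Rightarrow> ('x word \<Rightarrow> 'x word \<Rightarrow> bool) \<Rightarrow> ('x, 'k::field) ncpoly set \<Rightarrow>
   ('x, 'k) ncpoly \<times> ('x, 'k) ncpoly \<Rightarrow> ('x, 'k) ncpoly \<times> ('x, 'k) ncpoly \<Rightarrow> bool"
  for I lt P where
  reduce: "\<lbrakk>f \<noteq> 0; p \<in> P; LM lt f = v1 @ LM lt p @ v2;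
      involutive_at I (LM lt ` P) v1 (LM lt p) v2\<rbrakk> \<Longrightarrow>
    inv_reduction_step I lt P (f, r)
      (f - nc_term (LC lt f * inverse (LC lt p)) v1 * p * nc_mono v2, r)"
| move: "\<lbrakk>f \<noteq> 0; \<forall>p\<in>P. \<not> involutively_divides I (LM lt ` P) (LM lt p) (LM lt f)\<rbrakk> \<Longrightarrow>
    inv_reduction_step I lt P (f, r)
      (f - nc_term (LC lt f) (LM lt f), r + nc_term (LC lt f) (LM lt f))"

definition inv_reduces_to_zero ::
  "'x involutive_division \<Rightarrow> ('x word \<Rightarrow> 'x word \<Rightarrow> bool) \<Rightarrow> ('x, 'k::field) ncpoly set \<Rightarrow>
   ('x, 'k) ncpoly \<Rightarrow> bool" where
  "inv_reduces_to_zero I lt P f \<longleftrightarrow> (inv_reduction_step I lt P)\<^sup>*\<^sup>* (f, 0) (0, 0)"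

definition autoreduced ::
  "'x involutive_division \<Rightarrow> ('x word \<Rightarrow> 'x word \<Rightarrow> bool) \<Rightarrow> ('x, 'k::zero) ncpoly set \<Rightarrow> bool" where
  "autoreduced I lt P \<longleftrightarrow> (\<forall>p\<in>P. \<forall>w\<in>Poly_Mapping.keys p. \<forall>p'\<in>P - {p}.
    \<not> involutively_divides I (LM lt ` P) (LM lt p') w)"

definition locally_involutive_basis ::
  "'x involutive_division \<Rightarrow> ('x word \<Rightarrow> 'x word \<Rightarrow> bool) \<Rightarrow> ('x, 'k::field) ncpoly set \<Rightarrow> bool" where
  "locally_involutive_basis I lt P \<longleftrightarrow> finite P \<and> 0 \<notin> P \<and> autoreduced I lt P \<and>
    (\<forall>p\<in>P. \<forall>x. x \<notin> fst (I (LM lt p) (LM lt ` P)) \<longrightarrow>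
      inv_reduces_to_zero I lt P (nc_mono [x] * p)) \<and>
    (\<forall>p\<in>P. \<forall>x. x \<notin> snd (I (LM lt p) (LM lt ` P)) \<longrightarrow>
      inv_reduces_to_zero I lt P (p * nc_mono [x]))"

section \<open>The strong left overlap division\<close>

text \<open>The order on the type of letters is the order on the variables, so \<open>x\<^sub>1\<close> is the greatest letter
  and \<open>x\<^sub>n\<close> the least.\<close>

definition degrevlex :: "'x::linorder word \<Rightarrow> 'x word \<Rightarrow> bool" where
  "degrevlex m1 m2 \<longleftrightarrow> length m1 < length m2 \<or>
    length m1 = length m2 \<and>
      (\<exists>i<length m1. m1 ! i > m2 ! i \<and> (\<forall>j. i < j \<and> j < length m1 \<longrightarrow> m1 ! j = m2 ! j))"

text \<open>For finite \<open>U\<close>, the increasing enumeration \<open>u\<^sub>m, \<dots>, u\<^sub>1\<close>.\<close>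

definition degrevlex_list :: "'x::linorder word set \<Rightarrow> 'x word list" where
  "degrevlex_list U = (THE us. sorted_wrt degrevlex us \<and> set us = U)"

text \<open>Right nonmultiplicative variables of \<open>u\<close> after step 1, parts (a) and (b).\<close>

definition slo_step1 :: "'x word set \<Rightarrow> 'x word \<Rightarrow> 'x set" where
  "slo_step1 U u =
     {x. \<exists>u'\<in>U. u' \<noteq> u \<and> (\<exists>a b. u' = a @ u @ x # b)} \<union>
     {u' ! k | u' k. u' \<in> U \<and> 1 \<le> k \<and> k < min (length u') (length u) \<and>
        take k u' = drop (length u - k) u}"

text \<open>Step 2 transforms the assignment \<open>N\<close> of right nonmultiplicative variables; the outer loop is
  over \<open>u = u\<^sub>i\<close>, the inner one over \<open>u' = u\<^sub>j\<close>.\<close>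

definition slo_step2_inner :: "'x word \<Rightarrow> 'x word \<Rightarrow> ('x word \<Rightarrow> 'x set) \<Rightarrow> 'x word \<Rightarrow> 'x set" where
  "slo_step2_inner u u' N =
    (if u' \<noteq> [] \<and> set u' \<inter> N u = {} then N(u := insert (hd u') (N u)) else N)"

definition slo_step2 :: "'x word list \<Rightarrow> ('x word \<Rightarrow> 'x set) \<Rightarrow> 'x word \<Rightarrow> 'x set" where
  "slo_step2 us N = fold (\<lambda>u. fold (slo_step2_inner u) us) us N"

definition strong_left_overlap :: "'x::linorder involutive_division" where
  "strong_left_overlap u U = (UNIV, - slo_step2 (degrevlex_list U) (slo_step1 U) u)"

end

theory Submission
  imports Defs "HOL-Library.Infinite_Set"
begin

text \<open>All variables are left multiplicative, so a multiple \<open>a g b\<close> fails to be involutive only because of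
  the first letter \<open>x\<close> of \<open>b\<close>.  As the prolongation \<open>g x\<close> reduces to zero, \<open>a g b\<close> can then be replaced,
  modulo multiples with smaller leading monomial, by a multiple that is involutive or has a shorter right
  cofactor.  By step 1 of the division, involutive divisors of a word at two different factorisations
  never overlap, and disjoint ones give multiples that agree modulo smaller ones, as in Buchberger's
  product criterion.  Hence any two monic multiples of elements of the basis with a common leading
  monomial agree modulo multiples with smaller leading monomial.  Step 2 only adds nonmultiplicative
  variables and plays no role.\<close>

section \<open>Words and noncommutative polynomials\<close>

lemma single_mult_single_word: "nc_term c a * nc_term d b = nc_term (c * d) (a @ b)"
  by (simp add: mult_single plus_list_def)

lemma ncpoly_sum_terms: "p = (\<Sum>w\<in>Poly_Mapping.keys p. nc_term (Poly_Mapping.lookup p w) w)"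
  by (rule poly_mapping_eqI)
     (auto simp: lookup_sum lookup_single when_def sum.delta not_in_keys_iff_lookup_eq_zero)

lemma keys_mult_word:
  "Poly_Mapping.keys (p * q) \<subseteq> {v @ w |v w. v \<in> Poly_Mapping.keys p \<and> w \<in> Poly_Mapping.keys q}"
  using keys_mult[of p q] by (simp add: plus_list_def)

lemma keys_sandwich:
  assumes "w \<in> Poly_Mapping.keys (nc_term c a * p * nc_term d b)"
  shows "\<exists>v\<in>Poly_Mapping.keys p. w = a @ v @ b"
  using assms keys_mult_word[of "nc_term c a * p" "nc_term d b"] keys_mult_word[of "nc_term c a" p]
  by (fastforce split: if_splits)

section \<open>Admissible orderings\<close>

locale admissible_ordering =
  fixes lt :: "'x word \<Rightarrow> 'x word \<Rightarrow> bool"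
  assumes admissible: "admissible lt"
begin

lemma lt_irrefl [simp]: "\<not> lt w w"
  using admissible by (auto simp: admissible_def irreflp_def)

lemma lt_trans [trans]: "lt u v \<Longrightarrow> lt v w \<Longrightarrow> lt u w"
  using admissible unfolding admissible_def by (blast dest: transpD)

lemma lt_linear: "lt u v \<or> u = v \<or> lt v u"
  using admissible unfolding admissible_def totalp_on_def by blast

lemma lt_context: "lt u v \<Longrightarrow> lt (a @ u @ b) (a @ v @ b)"
  using admissible by (auto simp: admissible_def)

lemma Nil_lt: "w \<noteq> [] \<Longrightarrow> lt [] w"
  using admissible by (auto simp: admissible_def)

lemma lt_Cons_self: "lt w (x # w)"
  using lt_context[OF Nil_lt[of "[x]"], of "[]" w] by simp

text \<open>If the tails compared the other way, prepending \<open>x\<close> would preserve that, so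
  totality leaves only the claim. This is what allows a common first letter to be deleted throughout
  a descending sequence.\<close>

lemma lt_Cons_cancel: "lt (x # v) (x # w) \<Longrightarrow> lt v w"
  using lt_linear[of v w] lt_context[of w v "[x]" "[]"] lt_trans[of "x # v" "x # w" "x # v"] by auto

text \<open>Among the descending sequences choose one that has minimal length at every position.  With
  finitely many letters, infinitely many of its words share their first letter \<open>x\<close>; deleting \<open>x\<close> from
  these contradicts minimality.\<close>

lemma wfp_lt:
  assumes "finite (UNIV :: 'x set)"
  shows "wfp lt"
proof (rule ccontr)
  assume "\<not> wfp lt"
  then obtain s0 where s0: "\<And>i. lt (s0 (Suc i)) (s0 i)"
    unfolding wfp_def wf_iff_no_infinite_down_chain by auto
  define bad where "bad w \<longleftrightarrow> (\<exists>s. s 0 = w \<and> (\<forall>i. lt (s (Suc i)) (s i)))" for w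
  \<comment> \<open>\<open>P n v\<close> collects the candidates for position \<open>n\<close> after
    the predecessor \<open>v\<close>; position 0 has no predecessor, so \<open>v\<close> is ignored
    there.\<close>
  define P where "P n v w \<longleftrightarrow> bad w \<and> (n = 0 \<or> lt w v)" for n :: nat and v w
  define next_w where "next_w n v = arg_min length (P n v)" for n v
  have bad_step: "\<exists>w'. bad w' \<and> lt w' w" if "bad w" for w
  proof -
    obtain s where s: "s 0 = w" "\<And>i. lt (s (Suc i)) (s i)"
      using \<open>bad w\<close> unfolding bad_def by blast
    have "bad (s 1)" unfolding bad_def by (rule exI[of _ "\<lambda>i. s (Suc i)"]) (use s in auto)
    with s show ?thesis by (metis One_nat_def)
  qed
  have min: "P n v (next_w n v) \<and> (\<forall>w. P n v w \<longrightarrow> length (next_w n v) \<le> length w)"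
    if "\<exists>w. P n v w" for n v
    unfolding next_w_def using that arg_min_natI[of "P n v"] arg_min_nat_le[of "P n v"] by blast
  \<comment> \<open>Greedy construction: each \<open>t n\<close> is a shortest candidate at its
    position. The argument \<open>[]\<close> is a dummy predecessor for position 0.\<close>
  define t where "t = rec_nat (next_w 0 []) (\<lambda>n v. next_w (Suc n) v)"
  have t_Suc: "t (Suc n) = next_w (Suc n) (t n)" for n
    by (simp add: t_def)
  have t0: "bad (t 0)" "\<And>w. bad w \<Longrightarrow> length (t 0) \<le> length w"
    using min[of 0 "[]"] s0 by (auto simp: P_def bad_def t_def)
  have bad_t: "bad (t n)" for n
  proof (induction n)
    case 0 show ?case by (rule t0)
  next
    case (Suc n)
    then show ?case using min[of "Suc n" "t n"] bad_step[of "t n"] by (auto simp: P_def t_Suc)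
  qed
  have t_step: "lt (t (Suc n)) (t n)" "\<And>w. bad w \<Longrightarrow> lt w (t n) \<Longrightarrow> length (t (Suc n)) \<le> length w" for n
    using min[of "Suc n" "t n"] bad_step[OF bad_t[of n]] by (auto simp: P_def t_Suc)
  have t_mono: "lt (t j) (t i)" if "i < j" for i j
    using that by (induction j) (auto simp: less_Suc_eq intro: t_step lt_trans)
  have t_nonempty: "t n \<noteq> []" for n
    using t_step(1)[of n] Nil_lt[of "t (Suc n)"] by (metis lt_trans lt_irrefl)
  have "\<exists>x. infinite {n \<in> UNIV. hd (t n) = x}"
    using pigeonhole_infinite[of "UNIV :: nat set" "\<lambda>n. hd (t n)"]
      finite_subset[OF subset_UNIV assms] by auto
  then obtain x where inf: "infinite {n. hd (t n) = x}" by auto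
  \<comment> \<open>\<open>e\<close> lists in increasing order the positions whose word starts with
    \<open>x\<close>. They need not be adjacent, which is why \<open>t_mono\<close> is used
    below.\<close>
  define e where "e = Infinite_Set.enumerate {n. hd (t n) = x}"
  have e: "t (e k) = x # tl (t (e k))" "e k < e (Suc k)" for k
    using enumerate_in_set[OF inf, of k] enumerate_step[OF inf, of k] list.collapse[OF t_nonempty[of "e k"]]
    by (auto simp: e_def)
  have "lt (tl (t (e (Suc k)))) (tl (t (e k)))" for k
    using t_mono[OF e(2)[of k]] e(1)[of k] e(1)[of "Suc k"] by (metis lt_Cons_cancel)
  then have bad_tl: "bad (tl (t (e 0)))"
    unfolding bad_def by (intro exI[of _ "\<lambda>k. tl (t (e k))"]) auto
  have less: "lt (tl (t (e 0))) (t (e 0))" and len: "length (tl (t (e 0))) < length (t (e 0))"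
    using e(1)[of 0] lt_Cons_self by (metis, metis length_Cons lessI)
  \<comment> \<open>\<open>tl (t (e 0))\<close> would have been a shorter candidate at position
    \<open>e 0\<close>: at position 0 every bad word competes, later only those below the
    predecessor, and \<open>less\<close> provides that.\<close>
  show False
  proof (cases "e 0")
    case 0
    then show False using t0(2)[OF bad_tl] len by (metis linorder_not_less)
  next
    case (Suc n)
    then show False using t_step(2)[OF bad_tl, of n] t_step(1)[of n] less len lt_trans by fastforce
  qed
qed

section \<open>Leading monomials, their cancellation and their behaviour under multiplication by
  words\<close>

lemma LM_exists:
  assumes "finite A" "A \<noteq> {}"
  shows "\<exists>m\<in>A. \<forall>w\<in>A. w \<noteq> m \<longrightarrow> lt w m"
  using assms
proof (induction rule: finite_ne_induct)
  case (singleton x)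
  then show ?case by simp
next
  case (insert x A)
  then obtain m where m: "m \<in> A" "\<And>w. w \<in> A \<Longrightarrow> w \<noteq> m \<Longrightarrow> lt w m" by auto
  have "x \<noteq> m" using m(1) insert.hyps by auto
  then consider "lt x m" | "lt m x" using lt_linear[of x m] by auto
  then show ?case
  proof cases
    case 1
    then show ?thesis using m by (intro bexI[of _ m]) auto
  next
    case 2
    have "lt w x" if "w \<in> A" for w
      using m(2)[OF that] 2 lt_trans[of w m x] by auto
    then show ?thesis by (intro bexI[of _ x]) auto
  qed
qed

lemma LM_eqI:
  assumes "m \<in> Poly_Mapping.keys p" "\<And>w. w \<in> Poly_Mapping.keys p \<Longrightarrow> w \<noteq> m \<Longrightarrow> lt w m"
  shows "LM lt p = m"
  unfolding LM_def
proof (rule the_equality)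
  fix v
  assume "v \<in> Poly_Mapping.keys p \<and> (\<forall>w\<in>Poly_Mapping.keys p. w \<noteq> v \<longrightarrow> lt w v)"
  then show "v = m" using assms lt_trans[of v m v] lt_irrefl[of v] by metis
qed (use assms in auto)

lemma LM_in_keys: "p \<noteq> 0 \<Longrightarrow> LM lt p \<in> Poly_Mapping.keys p"
  and keys_lt_LM: "w \<in> Poly_Mapping.keys p \<Longrightarrow> w \<noteq> LM lt p \<Longrightarrow> lt w (LM lt p)"
proof -
  have *: "LM lt p \<in> Poly_Mapping.keys p \<and> (\<forall>w\<in>Poly_Mapping.keys p. w \<noteq> LM lt p \<longrightarrow> lt w (LM lt p))"
    if "p \<noteq> 0"
  proof -
    obtain m where "m \<in> Poly_Mapping.keys p" "\<forall>w\<in>Poly_Mapping.keys p. w \<noteq> m \<longrightarrow> lt w m"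
      using LM_exists[of "Poly_Mapping.keys p"] \<open>p \<noteq> 0\<close> by auto
    then show ?thesis using LM_eqI[of m p] by simp
  qed
  then show "p \<noteq> 0 \<Longrightarrow> LM lt p \<in> Poly_Mapping.keys p" by blast
  show "w \<in> Poly_Mapping.keys p \<Longrightarrow> w \<noteq> LM lt p \<Longrightarrow> lt w (LM lt p)"
    using * by (cases "p = 0") auto
qed

lemma LC_nonzero: "p \<noteq> 0 \<Longrightarrow> LC lt p \<noteq> 0"
  using LM_in_keys[of p] by (simp add: LC_def in_keys_iff)

text \<open>Equal coefficients at \<open>W\<close> cancel, so the weak bound becomes strict. Both
  the tail of a polynomial and the result of a reduction step are instances.\<close>

lemma keys_diff_lt:
  fixes f :: "('x, 'k::ab_group_add) ncpoly"
  assumes "\<And>w. w \<in> Poly_Mapping.keys f \<Longrightarrow> w = W \<or> lt w W"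
    and "\<And>w. w \<in> Poly_Mapping.keys h \<Longrightarrow> w = W \<or> lt w W"
    and "Poly_Mapping.lookup f W = Poly_Mapping.lookup h W"
    and "w \<in> Poly_Mapping.keys (f - h)"
  shows "lt w W"
proof -
  have "w \<noteq> W" using assms(3,4) by (auto simp: in_keys_iff lookup_minus)
  moreover have "w \<in> Poly_Mapping.keys f \<or> w \<in> Poly_Mapping.keys h"
    using keys_diff[of f h] assms(4) by blast
  ultimately show ?thesis using assms(1,2) by blast
qed

lemma keys_minus_leading_term:
  fixes p :: "('x, 'k::ab_group_add) ncpoly"
  assumes "w \<in> Poly_Mapping.keys (p - nc_term (LC lt p) (LM lt p))"
  shows "lt w (LM lt p)"
proof (rule keys_diff_lt[OF _ _ _ assms])
  fix v
  show "v = LM lt p \<or> lt v (LM lt p)" if "v \<in> Poly_Mapping.keys p"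
    using that keys_lt_LM by blast
  show "v = LM lt p \<or> lt v (LM lt p)" if "v \<in> Poly_Mapping.keys (nc_term (LC lt p) (LM lt p))"
    using that by (simp split: if_splits)
qed (simp add: LC_def)

lemma keys_multiple:
  assumes "w \<in> Poly_Mapping.keys (nc_term c a * p * nc_term d b)"
  shows "w = a @ LM lt p @ b \<or> lt w (a @ LM lt p @ b)"
  using keys_sandwich[OF assms] keys_lt_LM[of _ p] lt_context[of _ "LM lt p" a b] by metis

text \<open>Split off the leading term of \<open>p\<close>. The tail does not contain
  \<open>LM lt p\<close>, so by cancellation of words its multiple does not contain
  \<open>a @ LM lt p @ b\<close>.\<close>

lemma lookup_multiple:
  fixes p :: "('x, 'k::field) ncpoly"
  shows "Poly_Mapping.lookup (nc_term c a * p * nc_mono b) (a @ LM lt p @ b) = c * LC lt p"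
proof -
  let ?q = "p - nc_term (LC lt p) (LM lt p)"
  have "a @ LM lt p @ b \<notin> Poly_Mapping.keys (nc_term c a * ?q * nc_mono b)"
    using keys_sandwich[of "a @ LM lt p @ b" a c ?q b 1] keys_minus_leading_term[of "LM lt p" p] by auto
  moreover have "nc_term c a * p * nc_mono b =
      nc_term c a * ?q * nc_mono b + nc_term (c * LC lt p) (a @ LM lt p @ b)"
    by (simp add: algebra_simps single_mult_single_word)
  ultimately show ?thesis
    by (simp add: lookup_add in_keys_iff)
qed

end

section \<open>Multiples of basis elements with bounded leading monomial\<close>

text \<open>\<open>D\<close> restricts the leading words of the individual summands, not that of the
  sum, as for standard representations. The words below \<open>W\<close> give congruence modulo
  smaller multiples; \<open>UNIV\<close> gives a set containing the whole ideal.\<close>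

inductive_set multiples_span ::
  "('x word \<Rightarrow> 'x word \<Rightarrow> bool) \<Rightarrow> ('x, 'k::field) ncpoly set \<Rightarrow> 'x word set \<Rightarrow> ('x, 'k) ncpoly set"
  for lt G D where
  zero: "0 \<in> multiples_span lt G D"
| add: "\<lbrakk>h \<in> multiples_span lt G D; g \<in> G; a @ LM lt g @ b \<in> D\<rbrakk> \<Longrightarrow>
    h + nc_term c a * g * nc_mono b \<in> multiples_span lt G D"

lemma multiples_span_multiple:
  "g \<in> G \<Longrightarrow> a @ LM lt g @ b \<in> D \<Longrightarrow> nc_term c a * g * nc_mono b \<in> multiples_span lt G D"
  using multiples_span.add[OF multiples_span.zero] by fastforce

lemma multiples_span_plus:
  assumes "h' \<in> multiples_span lt G D" "h \<in> multiples_span lt G D"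
  shows "h + h' \<in> multiples_span lt G D"
  using assms(1)
proof induction
  case zero
  then show ?case using assms(2) by simp
next
  case (add h' g a b c)
  then show ?case using multiples_span.add[of "h + h'" lt G D g a b c] by (simp add: add.assoc)
qed

lemma multiples_span_sandwich:
  assumes "h \<in> multiples_span lt G D" "\<And>w. w \<in> D \<Longrightarrow> l @ w @ r \<in> D'"
  shows "nc_term c l * h * nc_mono r \<in> multiples_span lt G D'"
  using assms(1)
proof induction
  case zero
  then show ?case by (simp add: multiples_span.zero)
next
  case (add h g a b d)
  have "nc_term c l * (nc_term d a * g * nc_mono b) * nc_mono r =
      nc_term c l * nc_term d a * g * (nc_mono b * nc_mono r)"
    by (simp only: mult.assoc)
  also have "\<dots> = nc_term (c * d) (l @ a) * g * nc_mono (b @ r)"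
    by (simp add: single_mult_single_word)
  finally show ?case
    using multiples_span.add[OF add.IH add.hyps(2), of "l @ a" "b @ r" "c * d"] assms(2)[OF add.hyps(3)]
    by (simp add: distrib_left distrib_right)
qed

lemma multiples_span_scale:
  assumes "h \<in> multiples_span lt G D"
  shows "nc_term c [] * h \<in> multiples_span lt G D"
proof -
  have "nc_term c [] * h * nc_mono [] \<in> multiples_span lt G D"
    by (rule multiples_span_sandwich[OF assms]) simp
  \<comment> \<open>Reading \<open>[]\<close> as the monoid unit \<open>0\<close> identifies
    \<open>nc_mono []\<close> with \<open>1\<close>.\<close>
  then show ?thesis by (simp flip: zero_list_def)
qed

lemma multiples_span_uminus:
  assumes "h \<in> multiples_span lt G D"
  shows "- h \<in> multiples_span lt G D"
  using multiples_span_scale[OF assms, of "- 1"] by (simp flip: zero_list_def add: single_uminus)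

lemma multiples_span_diff:
  assumes "h \<in> multiples_span lt G D" "h' \<in> multiples_span lt G D"
  shows "h - h' \<in> multiples_span lt G D"
  using multiples_span_plus[OF multiples_span_uminus[OF assms(2)] assms(1)] by simp

lemma multiples_span_sum:
  "(\<And>i. i \<in> A \<Longrightarrow> h i \<in> multiples_span lt G D) \<Longrightarrow> sum h A \<in> multiples_span lt G D"
  by (induction A rule: infinite_finite_induct) (auto intro: multiples_span.zero multiples_span_plus)

text \<open>Expanding both cofactors into terms reduces this to the generating multiples, once every
  coefficient has been collected in the left cofactor.\<close>

lemma multiples_span_mult_both:
  assumes "g \<in> G"
    and "\<And>v w. v \<in> Poly_Mapping.keys p \<Longrightarrow> w \<in> Poly_Mapping.keys q \<Longrightarrow> v @ LM lt g @ w \<in> D"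
  shows "p * g * q \<in> multiples_span lt G D"
proof -
  have *: "nc_term c v * g * nc_term d w \<in> multiples_span lt G D"
    if "v \<in> Poly_Mapping.keys p" "w \<in> Poly_Mapping.keys q" for c d v w
  proof -
    have "nc_term c v * g * nc_term d w = nc_term c v * (g * nc_term d []) * nc_mono w"
      by (simp add: mult.assoc single_mult_single_word)
    \<comment> \<open>Constants are central because the coefficient field is commutative.\<close>
    also have "g * nc_term d [] = nc_term d [] * g"
      by (subst (1 2) ncpoly_sum_terms[of g])
         (simp add: sum_distrib_left sum_distrib_right single_mult_single_word mult.commute)
    also have "nc_term c v * (nc_term d [] * g) = nc_term (c * d) v * g"
      by (simp add: single_mult_single_word flip: mult.assoc)
    finally show ?thesis using multiples_span_multiple[of g G v lt w D] assms that by simp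
  qed
  have "p * g * q = (\<Sum>v\<in>Poly_Mapping.keys p. \<Sum>w\<in>Poly_Mapping.keys q.
      nc_term (Poly_Mapping.lookup p v) v * g * nc_term (Poly_Mapping.lookup q w) w)"
    by (subst ncpoly_sum_terms[of p], subst ncpoly_sum_terms[of q])
       (simp only: sum_distrib_left sum_distrib_right, rule sum.swap)
  then show ?thesis using * by (simp add: multiples_span_sum)
qed

lemma multiples_span_mono:
  assumes "h \<in> multiples_span lt G D" "D \<subseteq> D'"
  shows "h \<in> multiples_span lt G D'"
  using assms(1) by induction (use assms(2) in \<open>auto intro: multiples_span.intros\<close>)

text \<open>The span without a bound is itself a two-sided ideal containing \<open>G\<close>, and
  the hull is the least one.\<close>

lemma hull_subset_multiples_span: "two_sided_ideal hull G \<subseteq> multiples_span lt G UNIV"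
proof (rule hull_minimal)
  show "G \<subseteq> multiples_span lt G UNIV"
    using multiples_span_mult_both[of _ G 1 1] by auto
  have "r * a * s \<in> multiples_span lt G UNIV" if "a \<in> multiples_span lt G UNIV" for a r s
    using that
  proof induction
    case zero
    then show ?case by (simp add: multiples_span.zero)
  next
    case (add h g v w c)
    have "r * nc_term c v * g * (nc_mono w * s) \<in> multiples_span lt G UNIV"
      using add.hyps by (simp add: multiples_span_mult_both)
    then show ?case
      using multiples_span_plus[OF _ add.IH] by (simp add: distrib_left distrib_right mult.assoc)
  qed
  then show "two_sided_ideal (multiples_span lt G UNIV)"
    by (auto simp: two_sided_ideal_def intro: multiples_span.zero multiples_span_plus)
qed

text \<open>For \<open>g \<noteq> 0\<close> the coefficient at \<open>a @ LM lt g @ b\<close> is 1,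
  so leading terms cancel in the difference of two such multiples with the same leading
  word.\<close>

definition monic_multiple ::
  "('x word \<Rightarrow> 'x word \<Rightarrow> bool) \<Rightarrow> 'x word \<Rightarrow> ('x, 'k::field) ncpoly \<Rightarrow> 'x word \<Rightarrow> ('x, 'k) ncpoly" where
  "monic_multiple lt a g b = nc_term (inverse (LC lt g)) a * g * nc_mono b"

lemma monic_multiple_sandwich:
  "nc_mono l * monic_multiple lt a g b * nc_mono r = monic_multiple lt (l @ a) g (b @ r)"
proof -
  have "nc_mono l * monic_multiple lt a g b * nc_mono r =
      nc_mono l * nc_term (inverse (LC lt g)) a * g * (nc_mono b * nc_mono r)"
    by (simp only: monic_multiple_def mult.assoc)
  then show ?thesis by (simp add: single_mult_single_word monic_multiple_def)
qed

lemma scalar_monic_multiple: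
  "nc_term c [] * monic_multiple lt a g b = nc_term (c * inverse (LC lt g)) a * g * nc_mono b"
  by (simp add: monic_multiple_def single_mult_single_word flip: mult.assoc)

section \<open>Congruence modulo smaller multiples and the Groebner basis criterion\<close>

context admissible_ordering
begin

abbreviation below :: "('x, 'k::field) ncpoly set \<Rightarrow> 'x word \<Rightarrow> ('x, 'k) ncpoly set" where
  "below G W \<equiv> multiples_span lt G {w. lt w W}"

abbreviation up_to :: "('x, 'k::field) ncpoly set \<Rightarrow> 'x word \<Rightarrow> ('x, 'k) ncpoly set" where
  "up_to G W \<equiv> multiples_span lt G {w. w = W \<or> lt w W}"

lemma keys_multiples_span:
  assumes "h \<in> multiples_span lt G D" "w \<in> Poly_Mapping.keys h"
  shows "\<exists>v\<in>D. w = v \<or> lt w v"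
  using assms
proof (induction arbitrary: w)
  case zero
  then show ?case by simp
next
  case (add h g a b c)
  consider "w \<in> Poly_Mapping.keys h" | "w \<in> Poly_Mapping.keys (nc_term c a * g * nc_mono b)"
    using keys_add[of h "nc_term c a * g * nc_mono b"] add.prems by auto
  then show ?case
  proof cases
    case 1
    then show ?thesis by (rule add.IH)
  next
    case 2
    from keys_multiple[OF this] add.hyps(3) show ?thesis by (rule bexI)
  qed
qed

lemma up_to_mono:
  assumes "h \<in> up_to G V" "V = W \<or> lt V W"
  shows "h \<in> up_to G W"
  using assms(1)
proof (rule multiples_span_mono)
  show "{w. w = V \<or> lt w V} \<subseteq> {w. w = W \<or> lt w W}"
    using assms(2) by (auto intro: lt_trans)
qed

text \<open>The largest leading word among the finitely many summands serves as \<open>V\<close>.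
  This turns a strict bound \<open>W\<close> into a weak bound by some smaller word, as well-founded
  induction on the bound requires.\<close>

lemma multiples_span_up_to:
  assumes "h \<in> multiples_span lt G D" "h \<noteq> 0"
  shows "\<exists>V\<in>D. h \<in> up_to G V"
proof -
  have "h = 0 \<or> (\<exists>V\<in>D. h \<in> up_to G V)"
    using assms(1)
  proof induction
    case (add h g a b c)
    let ?m = "a @ LM lt g @ b"
    have m: "nc_term c a * g * nc_mono b \<in> up_to G ?m"
      using multiples_span_multiple[OF add.hyps(2)] by simp
    from add.IH show ?case
    proof (elim disjE bexE)
      assume "h = 0"
      then show ?thesis using m add.hyps(3) by auto
    next
      fix V
      assume V: "V \<in> D" "h \<in> up_to G V"
      define V' where "V' = (if lt V ?m then ?m else V)"
      have "?m = V' \<or> lt ?m V'" "V = V' \<or> lt V V'"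
        using lt_linear[of ?m V] by (auto simp: V'_def)
      then have "h + nc_term c a * g * nc_mono b \<in> up_to G V'"
        by (intro multiples_span_plus up_to_mono[OF m] up_to_mono[OF V(2)])
      moreover have "V' \<in> D" using V(1) add.hyps(3) by (simp add: V'_def)
      ultimately show ?thesis by auto
    qed
  qed simp
  with assms(2) show ?thesis by simp
qed

text \<open>The Buchberger--Bergman criterion, applied to all pairs of multiples with a common leading
  monomial instead of only the overlaps.\<close>

lemma groebner_basis_if_monic_multiples_congruent:
  fixes G :: "('x, 'k::field) ncpoly set"
  assumes "finite (UNIV :: 'x set)" and "0 \<notin> G"
    and congruent: "\<And>g h a b c d. \<lbrakk>g \<in> G; h \<in> G; a @ LM lt g @ b = c @ LM lt h @ d\<rbrakk> \<Longrightarrow>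
      monic_multiple lt a g b - monic_multiple lt c h d \<in> below G (a @ LM lt g @ b)"
  shows "groebner_basis lt G (two_sided_ideal hull G)"
proof -
  \<comment> \<open>All summands that reach \<open>W\<close> collapse, modulo smaller ones, into one
    scalar multiple of a single monic multiple.\<close>
  have split: "f \<in> below G W \<or> (\<exists>e a g b. g \<in> G \<and> W = a @ LM lt g @ b \<and>
      f - nc_term e [] * monic_multiple lt a g b \<in> below G W)" if "f \<in> up_to G W" for f W
    using that
  proof induction
    case zero
    then show ?case by (simp add: multiples_span.zero)
  next
    case (add h g a b c)
    let ?p = "nc_term c a * g * nc_mono b"
    have p: "?p = nc_term (c * LC lt g) [] * monic_multiple lt a g b"
    proof -
      have "g \<noteq> 0" using add.hyps(2) \<open>0 \<notin> G\<close> by auto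
      then show ?thesis using LC_nonzero[of g]
        by (simp add: scalar_monic_multiple mult.assoc[of c "LC lt g"])
    qed
    show ?case
    proof (cases "lt (a @ LM lt g @ b) W")
      case True
      then have *: "?p \<in> below G W" by (simp add: multiples_span_multiple[OF add.hyps(2)])
      from add.IH show ?thesis
      proof (elim disjE exE conjE)
        assume "h \<in> below G W"
        then show ?thesis by (intro disjI1 multiples_span_plus[OF *])
      next
        fix e a' b' and g' :: "('x, 'k) ncpoly"
        let ?m = "nc_term e [] * monic_multiple lt a' g' b'"
        assume g': "g' \<in> G" "W = a' @ LM lt g' @ b'" "h - ?m \<in> below G W"
        have "h + ?p - ?m \<in> below G W"
          using multiples_span_plus[OF * g'(3)] by (simp add: diff_add_eq)
        with g' show ?thesis by (intro disjI2 exI[of _ e] exI[of _ a'] exI[of _ g'] exI[of _ b'] conjI)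
      qed
    next
      case False
      with add.hyps(3) have W: "W = a @ LM lt g @ b" by auto
      from add.IH show ?thesis
      proof (elim disjE exE conjE)
        assume "h \<in> below G W"
        then have "h + ?p - nc_term (c * LC lt g) [] * monic_multiple lt a g b \<in> below G W"
          using p by simp
        with W add.hyps(2) show ?thesis
          by (intro disjI2 exI[of _ "c * LC lt g"] exI[of _ a] exI[of _ g] exI[of _ b] conjI)
      next
        fix e a' g' b'
        assume *: "g' \<in> G" "W = a' @ LM lt g' @ b'"
          "h - nc_term e [] * monic_multiple lt a' g' b' \<in> below G W"
        have "monic_multiple lt a' g' b' - monic_multiple lt a g b \<in> below G W"
          using congruent[of g' g a' b' a b] * W add.hyps(2) by simp
        then have "nc_term e [] * (monic_multiple lt a' g' b' - monic_multiple lt a g b) \<in> below G W"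
          by (rule multiples_span_scale)
        from multiples_span_plus[OF this *(3)]
        have "h + ?p - nc_term (e + c * LC lt g) [] * monic_multiple lt a g b \<in> below G W"
          unfolding p by (simp add: single_add distrib_right right_diff_distrib)
        with W add.hyps(2) show ?thesis
          by (intro disjI2 exI[of _ "e + c * LC lt g"] exI[of _ a] exI[of _ g] exI[of _ b] conjI)
      qed
    qed
  qed
  \<comment> \<open>Well-founded induction on the bound \<open>W\<close>: either the part at
    \<open>W\<close> vanishes and the bound drops, or \<open>W\<close> is the leading monomial of
    \<open>f\<close>.\<close>
  have main: "\<exists>g\<in>G. sublist (LM lt g) (LM lt f)" if "f \<in> up_to G W" "f \<noteq> 0" for f W
    using wfp_lt[OF assms(1)] that
  proof (induction W arbitrary: f rule: wfp_induct_rule)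
    case (less W)
    have smaller: ?case if "f \<in> below G W"
      using multiples_span_up_to[OF that less.prems(2)] less.IH less.prems(2) by fastforce
    from split[OF less.prems(1)] show ?case
    proof (elim disjE exE conjE)
      fix e a g b
      assume g: "g \<in> G" "W = a @ LM lt g @ b"
        "f - nc_term e [] * monic_multiple lt a g b \<in> below G W"
      let ?m = "nc_term e [] * monic_multiple lt a g b"
      show ?case
      proof (cases "e = 0")
        case True
        with g(3) show ?thesis by (intro smaller) simp
      next
        case False
        \<comment> \<open>The smaller summands cannot touch \<open>W\<close>, so \<open>W\<close>
          occurs in \<open>f\<close> with the nonzero coefficient \<open>e\<close>.\<close>
        have "W \<notin> Poly_Mapping.keys (f - ?m)"
        proof
          assume "W \<in> Poly_Mapping.keys (f - ?m)"
          from keys_multiples_span[OF g(3) this] obtain v where "lt v W" "W = v \<or> lt W v" by auto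
          then show False using lt_trans[of W v W] by auto
        qed
        moreover have "Poly_Mapping.lookup ?m W = e"
        proof -
          have "g \<noteq> 0" using g(1) \<open>0 \<notin> G\<close> by auto
          then show ?thesis using LC_nonzero[of g] g(2)
            by (simp add: scalar_monic_multiple lookup_multiple mult.assoc[of e])
        qed
        ultimately have "W \<in> Poly_Mapping.keys f"
          using False by (simp add: in_keys_iff lookup_minus)
        then have "LM lt f = W"
        proof (rule LM_eqI)
          fix v
          assume "v \<in> Poly_Mapping.keys f" "v \<noteq> W"
          then show "lt v W"
            using keys_multiples_span[OF less.prems(1), of v] by (auto intro: lt_trans)
        qed
        then show ?thesis using g by (auto simp: sublist_def)
      qed
    qed (rule smaller)
  qed
  have "\<exists>g\<in>G. g \<noteq> 0 \<and> sublist (LM lt g) (LM lt f)" if "f \<in> two_sided_ideal hull G" "f \<noteq> 0" for f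
  proof -
    have "f \<in> multiples_span lt G UNIV" using hull_subset_multiples_span that(1) by blast
    from multiples_span_up_to[OF this that(2)] obtain V where "f \<in> up_to G V" by auto
    from main[OF this that(2)] show ?thesis using \<open>0 \<notin> G\<close> by metis
  qed
  then show ?thesis by (auto simp: groebner_basis_def)
qed

text \<open>For monic \<open>g = u + g'\<close> and \<open>h = v + h'\<close> with leading words
  \<open>u\<close>, \<open>v\<close>: both \<open>g m v\<close> and \<open>u m h\<close> arise from
  \<open>g m h\<close>, by subtracting \<open>g m h'\<close> and \<open>g' m h\<close> respectively.
  These two products have only smaller leading words; in the proof they are \<open>?x\<close> and
  \<open>?y\<close>, and the common product is \<open>?z\<close>.\<close>

lemma disjoint_monic_multiples_congruent:
  fixes G :: "('x, 'k::field) ncpoly set"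
  assumes "g \<in> G" "h \<in> G" "0 \<notin> G"
  shows "monic_multiple lt a g (m @ LM lt h @ b) - monic_multiple lt (a @ LM lt g @ m) h b
    \<in> below G (a @ LM lt g @ m @ LM lt h @ b)"
proof -
  define tail where "tail p = p - nc_term (LC lt p) (LM lt p)" for p :: "('x, 'k) ncpoly"
  define i where "i = inverse (LC lt g)"
  define j where "j = inverse (LC lt h)"
  have nz: "i * LC lt g = 1" "j * LC lt h = 1"
  proof -
    have "g \<noteq> 0" "h \<noteq> 0" using assms by auto
    then show "i * LC lt g = 1" "j * LC lt h = 1" by (simp_all add: i_def j_def LC_nonzero)
  qed
  have tail: "p = nc_term (LC lt p) (LM lt p) + tail p" for p
    by (simp add: tail_def)
  let ?W = "a @ LM lt g @ m @ LM lt h @ b"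
  let ?x = "nc_term i a * g * (nc_term j m * tail h * nc_mono b)"
  let ?y = "(nc_term i a * tail g * nc_term j m) * h * nc_mono b"
  let ?z = "nc_term i a * g * (nc_term j m * h * nc_mono b)"
  have "?x \<in> below G ?W"
  proof (rule multiples_span_mult_both[OF assms(1)])
    fix v w
    assume v: "v \<in> Poly_Mapping.keys (nc_term i a)"
      and w: "w \<in> Poly_Mapping.keys (nc_term j m * tail h * nc_mono b)"
    obtain t where "t \<in> Poly_Mapping.keys (tail h)" "w = m @ t @ b"
      using keys_sandwich[OF w] by blast
    with v show "v @ LM lt g @ w \<in> {w. lt w ?W}"
      using lt_context[of t "LM lt h" "a @ LM lt g @ m" b] keys_minus_leading_term[of t h]
      by (simp add: tail_def split: if_splits)
  qed
  moreover have "?y \<in> below G ?W"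
  proof (rule multiples_span_mult_both[OF assms(2)])
    fix v w
    assume v: "v \<in> Poly_Mapping.keys (nc_term i a * tail g * nc_term j m)"
      and w: "w \<in> Poly_Mapping.keys (nc_mono b :: ('x, 'k) ncpoly)"
    obtain t where "t \<in> Poly_Mapping.keys (tail g)" "v = a @ t @ m"
      using keys_sandwich[OF v] by blast
    with w show "v @ LM lt h @ w \<in> {w. lt w ?W}"
      using lt_context[of t "LM lt g" a "m @ LM lt h @ b"] keys_minus_leading_term[of t g]
      by (simp add: tail_def)
  qed
  moreover have "monic_multiple lt a g (m @ LM lt h @ b) = ?z - ?x"
  proof -
    have "?z - ?x = nc_term i a * g * (nc_term j m * (h - tail h) * nc_mono b)"
      by (simp add: algebra_simps)
    also have "h - tail h = nc_term (LC lt h) (LM lt h)" by (simp add: tail_def)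
    also have "nc_term j m * \<dots> * nc_mono b = nc_mono (m @ LM lt h @ b)"
      by (simp add: single_mult_single_word nz)
    finally show ?thesis by (simp add: monic_multiple_def i_def)
  qed
  moreover have "monic_multiple lt (a @ LM lt g @ m) h b = ?z - ?y"
  proof -
    have "?z - ?y = (nc_term i a * (g - tail g) * nc_term j m) * h * nc_mono b"
      by (simp add: algebra_simps)
    also have "g - tail g = nc_term (LC lt g) (LM lt g)" by (simp add: tail_def)
    also have "nc_term i a * \<dots> * nc_term j m = nc_term j (a @ LM lt g @ m)"
      by (simp add: single_mult_single_word nz)
    finally show ?thesis by (simp add: monic_multiple_def j_def)
  qed
  ultimately show ?thesis
    using multiples_span_diff[of ?y lt G "{w. lt w ?W}" ?x] by simp
qed

section \<open>Involutive reduction\<close>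

lemma keys_reduce:
  fixes f :: "('x, 'k::field) ncpoly"
  assumes "p \<noteq> 0" "LM lt f = a @ LM lt p @ b"
    and "w \<in> Poly_Mapping.keys (f - nc_term (LC lt f * inverse (LC lt p)) a * p * nc_mono b)"
  shows "lt w (LM lt f)"
proof (rule keys_diff_lt[OF _ _ _ assms(3)])
  show "Poly_Mapping.lookup f (LM lt f) =
      Poly_Mapping.lookup (nc_term (LC lt f * inverse (LC lt p)) a * p * nc_mono b) (LM lt f)"
    using lookup_multiple[where c = "LC lt f * inverse (LC lt p)" and a = a and p = p and b = b]
      assms(2) LC_nonzero[OF assms(1)]
    by (simp add: LC_def)
qed (use keys_lt_LM keys_multiple assms(2) in metis)+

text \<open>The invariant is the sum of current polynomial and remainder: a move leaves it
  unchanged, a reduction subtracts a multiple whose leading word is that of the current polynomial,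
  hence below \<open>W\<close>.\<close>

lemma reduction_steps_congruent:
  assumes "0 \<notin> G" and "(inv_reduction_step I lt G)\<^sup>*\<^sup>* (f, r) (f', r')"
    and "\<forall>w\<in>Poly_Mapping.keys f. lt w W"
  shows "(f + r) - (f' + r') \<in> below G W"
  using assms(2,3)
proof (induction rule: converse_rtranclp_induct2)
  case refl
  then show ?case by (simp add: multiples_span.zero)
next
  case (step f r f1 r1)
  from step.hyps(1) show ?case
  proof cases
    case (reduce p a b)
    let ?h = "nc_term (LC lt f * inverse (LC lt p)) a * p * nc_mono b"
    have W: "lt (LM lt f) W" using step.prems LM_in_keys[OF reduce(3)] by simp
    have "p \<noteq> 0" using reduce assms(1) by blast
    then have "\<forall>w\<in>Poly_Mapping.keys f1. lt w W"
      using keys_reduce[of p f a b] reduce(1,5) lt_trans[OF _ W] by simp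
    then have "(f1 + r1) - (f' + r') \<in> below G W" by (rule step.IH)
    moreover have "?h \<in> below G W"
      using reduce W by (intro multiples_span_multiple) auto
    ultimately have "(f1 + r1) - (f' + r') + ?h \<in> below G W"
      by (rule multiples_span_plus[rotated])
    then show ?thesis using reduce by simp
  next
    case move
    have W: "lt (LM lt f) W" using step.prems LM_in_keys[OF move(3)] by simp
    have "\<forall>w\<in>Poly_Mapping.keys f1. lt w W"
      using keys_minus_leading_term[of _ f] move(1) lt_trans[OF _ W] by simp
    then show ?thesis using step.IH move by simp
  qed
qed

text \<open>The first step removes the leading term of \<open>f\<close> and yields the divisor
  \<open>p\<close>; all later steps act strictly below \<open>LM lt f\<close>.\<close>

lemma reduces_to_zero_congruent:
  assumes "0 \<notin> G" "inv_reduces_to_zero I lt G f" "f \<noteq> 0"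
  shows "\<exists>p a b. p \<in> G \<and> LM lt f = a @ LM lt p @ b \<and> involutive_at I (LM lt ` G) a (LM lt p) b \<and>
    f - nc_term (LC lt f * inverse (LC lt p)) a * p * nc_mono b \<in> below G (LM lt f)"
proof -
  obtain f1 r1 where step: "inv_reduction_step I lt G (f, 0) (f1, r1)"
    and steps: "(inv_reduction_step I lt G)\<^sup>*\<^sup>* (f1, r1) (0, 0)"
    using assms(2,3) unfolding inv_reduces_to_zero_def
    by (metis converse_rtranclpE prod.inject surj_pair)
  from step show ?thesis
  proof cases
    case (reduce p a b)
    then have "p \<noteq> 0" using assms(1) by blast
    then have "\<forall>w\<in>Poly_Mapping.keys f1. lt w (LM lt f)"
      using keys_reduce[of p f a b] reduce(1,5) by simp
    from reduction_steps_congruent[OF assms(1) steps this] reduce show ?thesis by auto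
  next
    \<comment> \<open>A first step of this kind is impossible: \<open>f\<close> would be a sum of
      multiples with leading words below its own leading monomial.\<close>
    case move
    then have "\<forall>w\<in>Poly_Mapping.keys f1. lt w (LM lt f)"
      using keys_minus_leading_term[of _ f] by simp
    from reduction_steps_congruent[OF assms(1) steps this] move have "f \<in> below G (LM lt f)"
      by simp
    from keys_multiples_span[OF this LM_in_keys[OF assms(3)]] obtain v
      where "lt v (LM lt f)" "LM lt f = v \<or> lt (LM lt f) v" by auto
    then have False using lt_trans[of "LM lt f" v "LM lt f"] by auto
    then show ?thesis ..
  qed
qed

text \<open>The first involutive divisor in the reduction of \<open>g x\<close> supplies
  \<open>p\<close>; dividing by \<open>LC lt g\<close> makes both multiples monic.\<close>

lemma prolongation_congruent:
  fixes G :: "('x, 'k::field) ncpoly set"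
  assumes "0 \<notin> G" "g \<in> G" "inv_reduces_to_zero I lt G (g * nc_mono [x])"
  shows "\<exists>p a b. p \<in> G \<and> LM lt g @ [x] = a @ LM lt p @ b \<and>
    involutive_at I (LM lt ` G) a (LM lt p) b \<and>
    monic_multiple lt [] g [x] - monic_multiple lt a p b \<in> below G (LM lt g @ [x])"
proof -
  let ?f = "g * nc_mono [x]" and ?m = "LM lt g @ [x]" and ?c = "LC lt g"
  have "g \<noteq> 0" using assms(1,2) by auto
  then have c: "?c \<noteq> 0" by (rule LC_nonzero)
  have f: "?f = nc_term 1 [] * g * nc_mono [x]"
    by (simp flip: zero_list_def)
  have look: "Poly_Mapping.lookup ?f ?m = ?c"
    unfolding f using lookup_multiple[where c = 1 and a = "[]" and p = g and b = "[x]"] by simp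
  have LM: "LM lt ?f = ?m"
  proof (rule LM_eqI)
    show "?m \<in> Poly_Mapping.keys ?f" using look c by (simp add: in_keys_iff)
    show "lt w ?m" if "w \<in> Poly_Mapping.keys ?f" "w \<noteq> ?m" for w
      using keys_multiple[OF that(1)[unfolded f]] that(2) by simp
  qed
  have "?f \<noteq> 0" using look c by (metis lookup_zero)
  from reduces_to_zero_congruent[OF assms(1,3) this] obtain p a b
    where p: "p \<in> G" "?m = a @ LM lt p @ b" "involutive_at I (LM lt ` G) a (LM lt p) b"
      "?f - nc_term (?c * inverse (LC lt p)) a * p * nc_mono b \<in> below G ?m"
    unfolding LM unfolding LC_def[of lt ?f] LM look by auto
  from multiples_span_scale[OF p(4), of "inverse ?c"]
  have "nc_term (inverse ?c) [] * (?f - nc_term ?c [] * monic_multiple lt a p b) \<in> below G ?m"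
    by (simp only: scalar_monic_multiple)
  moreover have "nc_term (inverse ?c) [] * (?f - nc_term ?c [] * monic_multiple lt a p b) =
      monic_multiple lt [] g [x] - monic_multiple lt a p b"
  proof -
    have "nc_term (inverse ?c) [] * (nc_term ?c [] * monic_multiple lt a p b) = monic_multiple lt a p b"
      using c by (simp add: single_mult_single_word flip: mult.assoc) (simp flip: zero_list_def)
    moreover have "nc_term (inverse ?c) [] * ?f = monic_multiple lt [] g [x]"
      by (simp add: monic_multiple_def mult.assoc)
    ultimately show ?thesis by (simp add: right_diff_distrib)
  qed
  ultimately show ?thesis using p by auto
qed

text \<open>Induction on the right cofactor. Only its first letter can obstruct involutivity, and
  then the prolongation by that letter is replaced by an involutive multiple. The left cofactor may
  grow freely, since all letters are left multiplicative.\<close>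

lemma involutive_multiple_congruent:
  fixes G :: "('x, 'k::field) ncpoly set"
  assumes "0 \<notin> G"
    and left: "\<And>g. g \<in> G \<Longrightarrow> fst (I (LM lt g) (LM lt ` G)) = UNIV"
    and prolongations: "\<And>g x. \<lbrakk>g \<in> G; x \<notin> snd (I (LM lt g) (LM lt ` G))\<rbrakk> \<Longrightarrow>
      inv_reduces_to_zero I lt G (g * nc_mono [x])"
    and "g \<in> G"
  shows "\<exists>h c d. h \<in> G \<and> a @ LM lt g @ b = c @ LM lt h @ d \<and>
    involutive_at I (LM lt ` G) c (LM lt h) d \<and>
    monic_multiple lt a g b - monic_multiple lt c h d \<in> below G (a @ LM lt g @ b)"
  using \<open>g \<in> G\<close>
proof (induction b arbitrary: a g)
  case Nil
  then show ?case
    using left by (intro exI[of _ g] exI[of _ a] exI[of _ "[]"])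
      (simp add: involutive_at_def multiples_span.zero)
next
  case (Cons x b)
  show ?case
  proof (cases "x \<in> snd (I (LM lt g) (LM lt ` G))")
    case True
    then show ?thesis
      using left Cons.prems by (intro exI[of _ g] exI[of _ a] exI[of _ "x # b"])
        (simp add: involutive_at_def multiples_span.zero)
  next
    case False
    let ?W = "a @ LM lt g @ x # b"
    from prolongation_congruent[OF assms(1) Cons.prems prolongations[OF Cons.prems False]]
    obtain p c d where p: "p \<in> G" "LM lt g @ [x] = c @ LM lt p @ d"
      "involutive_at I (LM lt ` G) c (LM lt p) d"
      "monic_multiple lt [] g [x] - monic_multiple lt c p d \<in> below G (LM lt g @ [x])"
      by blast
    have W: "?W = (a @ c) @ LM lt p @ (d @ b)"
      using arg_cong[OF p(2), of "\<lambda>w. a @ w @ b"] by simp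
    have "nc_mono a * (monic_multiple lt [] g [x] - monic_multiple lt c p d) * nc_mono b \<in> below G ?W"
      using p(4) by (rule multiples_span_sandwich) (use lt_context[of _ "LM lt g @ [x]" a b] in auto)
    then have cong: "monic_multiple lt a g (x # b) - monic_multiple lt (a @ c) p (d @ b) \<in> below G ?W"
      using monic_multiple_sandwich[of a lt "[]" g "[x]" b] monic_multiple_sandwich[of a lt c p d b]
      by (simp add: algebra_simps)
    show ?thesis
    proof (cases "d = []")
      \<comment> \<open>The first letter of \<open>d @ b\<close> is that of \<open>d\<close>,
        already multiplicative for \<open>LM lt p\<close>.\<close>
      case False
      then have "involutive_at I (LM lt ` G) (a @ c) (LM lt p) (d @ b)"
        using p(3) left[OF p(1)] by (simp add: involutive_at_def)
      then show ?thesis using cong p(1) W by blast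
    next
      \<comment> \<open>The new right cofactor is \<open>b\<close> itself, one letter shorter than
        \<open>x # b\<close>, so the induction hypothesis applies.\<close>
      case True
      from Cons.IH[OF p(1), of "a @ c"] obtain h c' d' where h: "h \<in> G"
        "(a @ c) @ LM lt p @ b = c' @ LM lt h @ d'" "involutive_at I (LM lt ` G) c' (LM lt h) d'"
        "monic_multiple lt (a @ c) p b - monic_multiple lt c' h d' \<in> below G ((a @ c) @ LM lt p @ b)"
        by blast
      have eq: "(a @ c) @ LM lt p @ b = ?W" using W True by simp
      have "monic_multiple lt (a @ c) p (d @ b) - monic_multiple lt c' h d' \<in> below G ?W"
        and W': "?W = c' @ LM lt h @ d'"
        using h(4)[unfolded eq] h(2)[unfolded eq] True by simp_all
      from multiples_span_plus[OF this(1) cong]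
      have "monic_multiple lt a g (x # b) - monic_multiple lt c' h d' \<in> below G ?W"
        by simp
      with h(1,3) W' show ?thesis by (intro exI[of _ h] exI[of _ c'] exI[of _ d'] conjI)
    qed
  qed
qed

end

section \<open>The strong left overlap division\<close>

text \<open>Updates only insert variables, so whatever step 1 declares nonmultiplicative stays
  so.\<close>

lemma slo_step2_increasing: "N u \<subseteq> slo_step2 us N u"
proof -
  have inner: "N u \<subseteq> fold (slo_step2_inner v) ws N u" for v ws N
  proof (induction ws arbitrary: N)
    case (Cons w ws)
    have "N u \<subseteq> slo_step2_inner v w N u" by (auto simp: slo_step2_inner_def)
    with Cons show ?case by fastforce
  qed simp
  have "N u \<subseteq> fold (\<lambda>v. fold (slo_step2_inner v) us) vs N u" for vs
  proof (induction vs arbitrary: N)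
    case (Cons v vs)
    then show ?case using inner[of N v us] by fastforce
  qed simp
  then show ?thesis by (simp add: slo_step2_def)
qed

lemma fst_strong_left_overlap [simp]: "fst (strong_left_overlap u U) = UNIV"
  by (simp add: strong_left_overlap_def)

lemma snd_strong_left_overlap_disjoint_step1:
  "x \<in> slo_step1 U u \<Longrightarrow> x \<notin> snd (strong_left_overlap u U)"
  using slo_step2_increasing[of "slo_step1 U" u] by (auto simp: strong_left_overlap_def)

text \<open>Here \<open>u'\<close> ends strictly to the right of \<open>u\<close>. If it began
  before the end of \<open>u\<close>, then \<open>u'\<close> would contain \<open>u\<close> away
  from its suffix position, or begin with a proper suffix of \<open>u\<close>; parts (a) and (b) of
  step 1 then make the letter after \<open>u\<close> nonmultiplicative.\<close>

lemma strong_left_overlap_involutive_disjoint: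
  assumes "u' \<in> U" "involutive_at strong_left_overlap U a u (y @ b')" "a @ u @ y = a' @ u'" "y \<noteq> []"
  shows "\<exists>m. y = m @ u'"
proof (rule ccontr)
  assume no: "\<not> ?thesis"
  have y: "y = hd y # tl y" using assms(4) by simp
  have mult: "hd y \<notin> slo_step1 U u"
    using assms(2,4) snd_strong_left_overlap_disjoint_step1 by (auto simp: involutive_at_def)
  from assms(3) no obtain d where d: "a @ u = a' @ d" "u' = d @ y" "d \<noteq> []"
    by (metis append.assoc append_eq_append_conv2 append_self_conv2)
  \<comment> \<open>\<open>d\<close> is the part of \<open>u'\<close> in front of \<open>y\<close>.
    It either covers all of \<open>u\<close> (the case \<open>d = u\<close> included) or is a proper
    suffix of \<open>u\<close>, where \<open>length d\<close> is the overlap length \<open>k\<close>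
    of step 1.\<close>
  from d(1) consider e where "d = e @ u" | e where "u = e @ d" "e \<noteq> []"
    by (metis append_eq_append_conv2 append_Nil)
  then show False
  proof cases
    case (1 e)
    with d y have "u' = e @ u @ hd y # tl y" by simp
    moreover have "length u < length u'" using 1 d(2) assms(4) by simp
    then have "u' \<noteq> u" by auto
    ultimately have "hd y \<in> slo_step1 U u" using assms(1) unfolding slo_step1_def by blast
    with mult show False ..
  next
    case (2 e)
    have "u' ! length d = hd y"
      using d(2) assms(4) by (simp add: nth_append hd_conv_nth)
    moreover have "1 \<le> length d" "length d < min (length u') (length u)"
      "take (length d) u' = drop (length u - length d) u"
      using d(2,3) 2 assms(4) by (simp_all add: Suc_le_eq)
    ultimately have "hd y \<in> slo_step1 U u"
      unfolding slo_step1_def using assms(1)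
      by (intro UnI2 CollectI exI[of _ u'] exI[of _ "length d"]) simp
    with mult show False ..
  qed
qed

section \<open>Comparing two multiples with the same leading word\<close>

context admissible_ordering
begin

text \<open>A divisor in suffix position has an empty right cofactor, so it is involutive as soon as
  all letters are left multiplicative; autoreducedness forbids this for distinct elements.\<close>

lemma autoreduced_LM_suffix:
  assumes "autoreduced I lt G" "0 \<notin> G" "g \<in> G" "h \<in> G" "LM lt h = e @ LM lt g"
    and "fst (I (LM lt g) (LM lt ` G)) = UNIV"
  shows "g = h"
proof (rule ccontr)
  assume "g \<noteq> h"
  moreover have "LM lt h \<in> Poly_Mapping.keys h"
  proof (rule LM_in_keys)
    show "h \<noteq> 0" using assms(2,4) by auto
  qed
  ultimately have "\<not> involutively_divides I (LM lt ` G) (LM lt g) (LM lt h)"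
    using assms(1,3,4) by (simp add: autoreduced_def)
  moreover have "involutively_divides I (LM lt ` G) (LM lt g) (LM lt h)"
    unfolding involutively_divides_def involutive_at_def using assms(5,6)
    by (intro exI[of _ e] exI[of _ "[]"]) simp
  ultimately show False ..
qed

end

text \<open>Involutivity is assumed for the divisor with the longer right cofactor, the one that
  ends no later. If both end together, one leading word is a suffix of the other and the multiples
  coincide; otherwise the divisors are disjoint.\<close>

lemma strong_left_overlap_multiples_congruent:
  fixes lt :: "'x::linorder word \<Rightarrow> 'x word \<Rightarrow> bool" and G :: "('x, 'k::field) ncpoly set"
  assumes "admissible lt"
    and "autoreduced strong_left_overlap lt G" "0 \<notin> G" "g \<in> G" "h \<in> G"
    and eq: "a @ LM lt g @ b = c @ LM lt h @ d" and "length d \<le> length b"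
    and "involutive_at strong_left_overlap (LM lt ` G) a (LM lt g) b"
  shows "monic_multiple lt a g b - monic_multiple lt c h d
    \<in> multiples_span lt G {w. lt w (a @ LM lt g @ b)}"
proof -
  interpret admissible_ordering lt by unfold_locales (rule assms(1))
  have "(a @ LM lt g) @ b = (c @ LM lt h) @ d" using eq by simp
  from append_eq_append_conv2[THEN iffD1, OF this] obtain z
    where "a @ LM lt g = (c @ LM lt h) @ z \<and> z @ b = d \<or>
      (a @ LM lt g) @ z = c @ LM lt h \<and> b = z @ d"
    by (elim exE)
  moreover have "z = []" if "z @ b = d" using \<open>length d \<le> length b\<close> that by auto
  \<comment> \<open>\<open>y\<close> is the stretch between the ends of the two divisors.\<close>
  ultimately obtain y where y: "b = y @ d" "a @ LM lt g @ y = c @ LM lt h"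
    by (metis append.assoc append_Nil append_Nil2)
  show ?thesis
  proof (cases "y = []")
    case True
    then have ac: "a @ LM lt g = c @ LM lt h" using y by simp
    from append_eq_append_conv2[THEN iffD1, OF this]
    consider e where "LM lt h = e @ LM lt g" | e where "LM lt g = e @ LM lt h"
      by metis
    then have "g = h"
    proof cases
      case 1
      from autoreduced_LM_suffix[OF assms(2-5) this fst_strong_left_overlap] show ?thesis .
    next
      case 2
      from autoreduced_LM_suffix[OF assms(2,3,5,4) this fst_strong_left_overlap] show ?thesis ..
    qed
    with y True ac show ?thesis by (simp add: multiples_span.zero)
  next
    case False
    obtain m where m: "y = m @ LM lt h"
      using strong_left_overlap_involutive_disjoint[of "LM lt h" "LM lt ` G" a "LM lt g" y d c]
        assms(5,8) y False by auto
    then have "c = a @ LM lt g @ m" using y by (metis append.assoc append_same_eq)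
    then show ?thesis
      using disjoint_monic_multiples_congruent[OF assms(4,5,3), of a m d] y m by simp
  qed
qed

theorem proposition5p5p20:
  fixes lt :: "'x::{finite, linorder} word \<Rightarrow> 'x word \<Rightarrow> bool"
    and G :: "('x, 'k::field) ncpoly set"
  assumes "admissible lt"
    and "finite G" and "0 \<notin> G"
    and "locally_involutive_basis strong_left_overlap lt G"
  shows "groebner_basis lt G (two_sided_ideal hull G)"
proof -
  interpret admissible_ordering lt by unfold_locales (rule assms(1))
  let ?I = strong_left_overlap
  have auto: "autoreduced ?I lt G"
    and prolongations: "\<And>g x. \<lbrakk>g \<in> G; x \<notin> snd (?I (LM lt g) (LM lt ` G))\<rbrakk> \<Longrightarrow>
      inv_reduces_to_zero ?I lt G (g * nc_mono [x])"
    using assms(4) by (auto simp: locally_involutive_basis_def)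
  show ?thesis
  proof (rule groebner_basis_if_monic_multiples_congruent[OF finite assms(3)])
    fix g h a b c d
    assume "g \<in> G" "h \<in> G" and eq: "a @ LM lt g @ b = c @ LM lt h @ d"
    let ?W = "a @ LM lt g @ b"
    obtain g' a' b' where g': "g' \<in> G" "?W = a' @ LM lt g' @ b'"
      "involutive_at ?I (LM lt ` G) a' (LM lt g') b'"
      "monic_multiple lt a g b - monic_multiple lt a' g' b' \<in> below G ?W"
      using involutive_multiple_congruent[OF assms(3) fst_strong_left_overlap prolongations \<open>g \<in> G\<close>]
      by metis
    obtain h' c' d' where h': "h' \<in> G" "?W = c' @ LM lt h' @ d'"
      "involutive_at ?I (LM lt ` G) c' (LM lt h') d'"
      "monic_multiple lt c h d - monic_multiple lt c' h' d' \<in> below G ?W"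
      using involutive_multiple_congruent[OF assms(3) fst_strong_left_overlap prolongations \<open>h \<in> G\<close>] eq
      by metis
    \<comment> \<open>Both multiples are involutive, so the one with the longer right cofactor can
      play the first role; exchanging them only changes the sign.\<close>
    have "monic_multiple lt a' g' b' - monic_multiple lt c' h' d' \<in> below G ?W"
    proof (cases "length d' \<le> length b'")
      case True
      show ?thesis
        using strong_left_overlap_multiples_congruent[OF assms(1) auto assms(3) g'(1) h'(1) _ True g'(3)]
          g'(2) h'(2) by metis
    next
      case False
      then have "monic_multiple lt c' h' d' - monic_multiple lt a' g' b' \<in> below G ?W"
        using strong_left_overlap_multiples_congruent[OF assms(1) auto assms(3) h'(1) g'(1) _ _ h'(3)]
          g'(2) h'(2) by (metis nat_le_linear)
      from multiples_span_uminus[OF this] show ?thesis by simp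
    qed
    from multiples_span_diff[OF multiples_span_plus[OF this g'(4)] h'(4)]
    show "monic_multiple lt a g b - monic_multiple lt c h d \<in> below G ?W" by simp
  qed
qed

end
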